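(* Let $m=1$, and let $a\in(0,1]$, $q>0$, $\beta_1>0$, $\beta_2>0$, $r,c\in\mathbb{R}$. Let $\mathcal{X}=[\underline{x},\bar{x}]$ and $\mathcal{D}=[\underline{d},\bar{d}]$ be nonempty compact real intervals satisfying the controllability condition $a\underline{x}+\bar{d}>\underline{x}$ and $a\bar{x}+\underline{d}<\bar{x}$. Consider the closed-loop system $$x(k+1)=a\,x(k)+d^*(x(k)),\qquad d^*(x)=\mathrm{Proj}_{(\mathcal{X}-ax)\cap\mathcal{D}}\left[\frac{rx+c-\beta_2}{q+\beta_1}\right],\quad x\in\mathcal{X}.$$ If $$\left|a+\frac{r}{q+\beta_1}\right|<1,$$ then the closed-loop system is exponentially stable in $\mathcal{X}$: there exist an equilibrium $x^*\in\mathcal{X}$ (that is, $x^*=ax^*+d^*(x^* )$), $M>0$ and $\rho\in(0,1)$ such that for every $x(0)\in\mathcal{X}$ and every integer $k\ge 0$, $$|x(k)-x^*|\le M\rho^k|x(0)-x^*|.$$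
   Context: For a nonempty closed convex set $C\subset\mathbb{R}$, $\mathrm{Proj}_C(y)$ is the nearest point of $C$ to $y$. For $x\in\mathbb{R}$, $\mathcal{X}-ax=\{x'-ax:\ x'\in\mathcal{X}\}$. The controllability condition guarantees that $(\mathcal{X}-ax)\cap\mathcal{D}$ is nonempty for every $x\in\mathcal{X}$, so $d^*$ is well defined on $\mathcal{X}$, and $ax+d^*(x)\in\mathcal{X}$ for $x\in\mathcal{X}$. Background: $x$ is the energy state of a distributed energy resource (DER) and $d$ its power consumption; $d^*(x)$ is the maximizer of the social welfare $-\frac12 qd^2+(rx+c)d-\frac12\beta_1d^2-\beta_2 d$ over $d\in\mathcal{D}$ with $ax+d\in\mathcal{X}$. *)

theory Defs
  imports "HOL-Analysis.Analysis"
begin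

(* Meaningful only when the intersection is nonempty (closest_point is unspecified on the
   empty set); the controllability condition ensures this for x in X. *)
definition proj_input ::
    "real \<Rightarrow> real \<Rightarrow> real \<Rightarrow> real \<Rightarrow> real \<Rightarrow> real \<Rightarrow> real set \<Rightarrow> real set \<Rightarrow> real \<Rightarrow> real" where
  "proj_input a q r c \<beta>\<^sub>1 \<beta>\<^sub>2 X D x =
     closest_point ((\<lambda>x'. x' - a * x) ` X \<inter> D) ((r * x + c - \<beta>\<^sub>2) / (q + \<beta>\<^sub>1))"

definition closed_loop_trajectory :: "real \<Rightarrow> (real \<Rightarrow> real) \<Rightarrow> (nat \<Rightarrow> real) \<Rightarrow> bool" where
  "closed_loop_trajectory a d x \<longleftrightarrow> (\<forall>k. x (Suc k) = a * x k + d (x k))"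

definition exponentially_stable_in :: "real set \<Rightarrow> real \<Rightarrow> (real \<Rightarrow> real) \<Rightarrow> bool" where
  "exponentially_stable_in X a d \<longleftrightarrow>
     (\<exists>xeq\<in>X. xeq = a * xeq + d xeq \<and>
        (\<exists>M>0. \<exists>\<rho>\<in>{0<..<1}. \<forall>x. closed_loop_trajectory a d x \<longrightarrow> x 0 \<in> X \<longrightarrow>
           (\<forall>k. \<bar>x k - xeq\<bar> \<le> M * \<rho> ^ k * \<bar>x 0 - xeq\<bar>)))"

end

theory Submission
  imports Defs
begin

text \<open>
  With \<open>L = a + r / (q + \<beta>\<^sub>1)\<close>, the closed-loop map is the affine map \<open>x \<mapsto> L x + t\<close>, truncated above by
  \<open>min (a x + d_hi) x_hi\<close> and below by \<open>max (a x + d_lo) x_lo\<close>, so its slopes are among \<open>L\<close>, \<open>a\<close>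
  and \<open>0\<close>. For \<open>a < 1\<close> it is a contraction of the state interval. For \<open>a = 1\<close> it need not
  be one, but then controllability says \<open>d_lo < 0 < d_hi\<close>, and the equilibrium is the
  fixed point of the affine map truncated to the state interval. Wherever the input saturates, the state
  moves towards the equilibrium by at least a fixed amount, which on a bounded interval is a
  fixed fraction of the distance.
\<close>

text \<open>The shape \<open>max l (min u y)\<close> of a nearest point in an interval, shifted by
  \<open>a * x\<close>; \<open>L\<close> and \<open>t\<close> stand for slope and intercept of the
  unconstrained closed loop.\<close>

definition saturated_affine ::
    "real \<Rightarrow> real \<Rightarrow> real \<Rightarrow> real \<Rightarrow> real \<Rightarrow> real \<Rightarrow> real \<Rightarrow> real \<Rightarrow> real" where
  "saturated_affine a L t x_lo x_hi d_lo d_hi x =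
     max (max (a * x + d_lo) x_lo) (min (min (a * x + d_hi) x_hi) (L * x + t))"

lemma closest_point_atLeastAtMost:
  fixes l u y :: real
  assumes "l \<le> u"
  shows "closest_point {l..u} y = max l (min u y)"
  using assms
  by (intro closest_point_unique[symmetric]) (auto simp: dist_real_def max_def min_def)

lemma abs_max_diff_le:
  fixes u v u' v' e :: real
  assumes "\<bar>u - u'\<bar> \<le> e" "\<bar>v - v'\<bar> \<le> e"
  shows "\<bar>max u v - max u' v'\<bar> \<le> e"
  using assms by (auto simp: max_def abs_if split: if_splits)

lemma abs_min_diff_le:
  fixes u v u' v' e :: real
  assumes "\<bar>u - u'\<bar> \<le> e" "\<bar>v - v'\<bar> \<le> e"
  shows "\<bar>min u v - min u' v'\<bar> \<le> e"
  using assms by (auto simp: min_def abs_if split: if_splits)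

text \<open>One-step shrinking towards the single point \<open>p\<close> can be iterated because
  \<open>X\<close> is invariant, and gives \<open>M = 1\<close>. No contraction between arbitrary
  pairs is asked for.\<close>

lemma exponentially_stable_inI:
  assumes eq: "p \<in> X" "a * p + d p = p"
    and \<rho>: "0 < \<rho>" "\<rho> < 1"
    and inv: "\<And>x. x \<in> X \<Longrightarrow> a * x + d x \<in> X"
    and contr: "\<And>x. x \<in> X \<Longrightarrow> \<bar>a * x + d x - p\<bar> \<le> \<rho> * \<bar>x - p\<bar>"
  shows "exponentially_stable_in X a d"
proof -
  have bound: "\<bar>x k - p\<bar> \<le> 1 * \<rho> ^ k * \<bar>x 0 - p\<bar>"
    if traj: "closed_loop_trajectory a d x" and "x 0 \<in> X" for x k
  proof -
    have step: "x (Suc k) = a * x k + d (x k)" for k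
      using traj by (simp add: closed_loop_trajectory_def)
    have mem: "x k \<in> X" for k
      by (induction k) (use \<open>x 0 \<in> X\<close> step inv in auto)
    show ?thesis
    proof (induction k)
      case (Suc k)
      have "\<bar>x (Suc k) - p\<bar> \<le> \<rho> * \<bar>x k - p\<bar>"
        using contr[OF mem] step by simp
      also have "\<dots> \<le> \<rho> * (1 * \<rho> ^ k * \<bar>x 0 - p\<bar>)"
        using Suc.IH \<rho>(1) by (intro mult_left_mono) auto
      finally show ?case by (simp add: mult.assoc)
    qed simp
  qed
  have "\<exists>M>0. \<exists>\<rho>\<in>{0<..<1}. \<forall>x. closed_loop_trajectory a d x \<longrightarrow> x 0 \<in> X \<longrightarrow>
      (\<forall>k. \<bar>x k - p\<bar> \<le> M * \<rho> ^ k * \<bar>x 0 - p\<bar>)"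
    using bound \<rho> by (intro exI[of _ "1::real"] conjI bexI[of _ \<rho>]) auto
  then show ?thesis
    unfolding exponentially_stable_in_def using eq by (intro bexI[of _ p]) auto
qed

context
  fixes a L t x_lo x_hi d_lo d_hi :: real
  assumes a_pos: "0 < a" and a_le: "a \<le> 1" and L: "\<bar>L\<bar> < 1"
    and x_le: "x_lo \<le> x_hi"
    and ctrl_lo: "x_lo < a * x_lo + d_hi" and ctrl_hi: "a * x_hi + d_lo < x_hi"
begin

abbreviation "g \<equiv> saturated_affine a L t x_lo x_hi d_lo d_hi"

lemma ctrl:
  assumes "x \<in> {x_lo..x_hi}"
  shows "x_lo < a * x + d_hi" "a * x + d_lo < x_hi"
proof -
  have "a * x_lo \<le> a * x" "a * x \<le> a * x_hi" using assms a_pos by auto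
  then show "x_lo < a * x + d_hi" "a * x + d_lo < x_hi" using ctrl_lo ctrl_hi by linarith+
qed

lemma saturated_affine_mem: "x \<in> {x_lo..x_hi} \<Longrightarrow> g x \<in> {x_lo..x_hi}"
  using ctrl[of x] x_le by (auto simp: saturated_affine_def)

text \<open>Each piece has slope \<open>a\<close>, \<open>L\<close> or 0, and taking
  \<open>max\<close> or \<open>min\<close> preserves a common Lipschitz constant.\<close>

lemma saturated_affine_lipschitz:
  "\<bar>g x - g y\<bar> \<le> max a \<bar>L\<bar> * \<bar>x - y\<bar>"
proof -
  have 1: "\<bar>(a * x + e) - (a * y + e)\<bar> \<le> max a \<bar>L\<bar> * \<bar>x - y\<bar>" for e
    using a_pos by (simp add: abs_mult mult_right_mono flip: right_diff_distrib)
  have 2: "\<bar>(L * x + t) - (L * y + t)\<bar> \<le> max a \<bar>L\<bar> * \<bar>x - y\<bar>"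
    by (simp add: abs_mult mult_right_mono flip: right_diff_distrib)
  have 3: "\<bar>e - e\<bar> \<le> max a \<bar>L\<bar> * \<bar>x - y\<bar>" for e :: real
    using a_pos by simp
  show ?thesis
    unfolding saturated_affine_def by (intro abs_max_diff_le abs_min_diff_le 1 2 3)
qed

lemma contraction_to_equilibrium_leaky:
  assumes "a < 1"
  shows "\<exists>p\<in>{x_lo..x_hi}. \<exists>\<rho>\<in>{0<..<1}. g p = p \<and> (\<forall>x\<in>{x_lo..x_hi}. \<bar>g x - p\<bar> \<le> \<rho> * \<bar>x - p\<bar>)"
proof -
  have "\<exists>!p. p \<in> {x_lo..x_hi} \<and> g p = p"
    using a_pos assms L x_le saturated_affine_mem saturated_affine_lipschitz
    by (intro Banach_fix[where c = "max a \<bar>L\<bar>"])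
       (auto simp: dist_real_def complete_eq_closed simp del: atLeastAtMost_iff)
  then obtain p where p: "p \<in> {x_lo..x_hi}" "g p = p" by blast
  have "\<bar>g x - p\<bar> \<le> max a \<bar>L\<bar> * \<bar>x - p\<bar>" for x
    using saturated_affine_lipschitz[of x p] p by simp
  then show ?thesis
    using p a_pos assms L by (intro bexI[of _ p] bexI[of _ "max a \<bar>L\<bar>"]) auto
qed

text \<open>Here the Lipschitz constant above is 1, so the equilibrium is given explicitly and only
  distances to it are shown to shrink.\<close>

lemma contraction_to_equilibrium_lossless:
  assumes "a = 1"
  shows "\<exists>p\<in>{x_lo..x_hi}. \<exists>\<rho>\<in>{0<..<1}. g p = p \<and> (\<forall>x\<in>{x_lo..x_hi}. \<bar>g x - p\<bar> \<le> \<rho> * \<bar>x - p\<bar>)"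
proof -
  \<comment> \<open>The unconstrained fixed point \<open>t / (1 - L)\<close>, clamped to the state
    interval.\<close>
  define p where "p = max x_lo (min x_hi (t / (1 - L)))"
  define \<delta> where "\<delta> = min d_hi (- d_lo)"
  define W where "W = x_hi - x_lo + 1"
  \<comment> \<open>Saturated steps gain at least \<open>\<delta>\<close>, which is at least the
    fraction \<open>\<delta> / W\<close> of the distance to \<open>p\<close>. The summand 1 in
    \<open>W\<close> covers a one-point interval; \<open>1/2\<close> keeps the rate positive when
    the other terms are not.\<close>
  define \<rho> where "\<rho> = max (1/2) (max \<bar>L\<bar> (1 - \<delta> / W))"
  have d: "d_lo < 0" "0 < d_hi" using ctrl_lo ctrl_hi assms by auto
  have \<delta>: "0 < \<delta>" "\<delta> \<le> d_hi" "\<delta> \<le> - d_lo" using d by (auto simp: \<delta>_def)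
  have W: "0 < W" using x_le by (simp add: W_def)
  have \<rho>: "0 < \<rho>" "\<rho> < 1" "\<bar>L\<bar> \<le> \<rho>" "1 - \<delta> / W \<le> \<rho>" using \<delta> W L by (auto simp: \<rho>_def)
  have p: "p \<in> {x_lo..x_hi}" using x_le by (auto simp: p_def)
  \<comment> \<open>Clamping from above is inactive if \<open>p < x_hi\<close>, so \<open>p\<close>
    is at least the unconstrained fixed point; \<open>1 - L > 0\<close> turns this into a sign at
    \<open>p\<close>. The next fact is the mirror image.\<close>
  have below: "L * p + t \<le> p" if "x_lo \<le> p" "p < x_hi"
  proof -
    have "t / (1 - L) \<le> p" using that by (auto simp: p_def max_def min_def split: if_splits)
    then show ?thesis using L by (auto simp: field_simps)
  qed
  have above: "p \<le> L * p + t" if "x_lo < p" "p \<le> x_hi"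
  proof -
    have "p \<le> t / (1 - L)" using that by (auto simp: p_def max_def min_def split: if_splits)
    then show ?thesis using L by (auto simp: field_simps)
  qed
  \<comment> \<open>As \<open>a = 1\<close>, \<open>p + d_lo < p < p + d_hi\<close>, so only the
    state bounds can be active at \<open>p\<close>.\<close>
  have fixed: "g p = p"
    using p d below above assms
    by (cases "p = x_lo"; cases "p = x_hi") (auto simp: saturated_affine_def max_def min_def)
  have "\<bar>g x - p\<bar> \<le> \<rho> * \<bar>x - p\<bar>" if x: "x \<in> {x_lo..x_hi}" for x
  proof -
    have "\<bar>x - p\<bar> \<le> W" using x p by (auto simp: W_def)
    then have "\<delta> / W * \<bar>x - p\<bar> \<le> \<delta>"
      using \<delta> W by (simp add: field_simps)
    moreover have "(1 - \<rho>) * \<bar>x - p\<bar> \<le> \<delta> / W * \<bar>x - p\<bar>"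
      using \<rho> by (intro mult_right_mono) auto
    ultimately have drift: "\<bar>x - p\<bar> - \<delta> \<le> \<rho> * \<bar>x - p\<bar>"
      by (simp add: algebra_simps)
    have "\<bar>L * (x - p)\<bar> \<le> \<rho> * \<bar>x - p\<bar>"
      using \<rho> by (simp add: abs_mult mult_right_mono)
    then have lin: "\<bar>(L * x + t) - (L * p + t)\<bar> \<le> \<rho> * \<bar>x - p\<bar>"
      by (simp add: algebra_simps)
    have nonneg: "0 \<le> \<rho> * \<bar>x - p\<bar>" using \<rho> by simp
    consider "x = p" | "x < p" | "p < x" by linarith
    then show ?thesis
    proof cases
      case 1
      then show ?thesis using fixed by simp
    next
      case 2
      then have "p \<le> L * p + t" using x p above by auto
      moreover have "p = x_hi \<or> L * p + t \<le> p" using below p by (cases "p < x_hi") auto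
      \<comment> \<open>The affine value is at least \<open>p\<close> minus the allowed error, and
        an input capped at \<open>d_hi\<close> still gains \<open>\<delta>\<close>. Overshoot is
        bounded by \<open>lin\<close> if \<open>p\<close> is fixed by the affine map, and by the cap
        \<open>x_hi\<close> if \<open>p = x_hi\<close>.\<close>
      ultimately show ?thesis
        using 2 x p lin drift nonneg \<delta> d assms unfolding saturated_affine_def
        by (auto simp: max_def min_def abs_if split: if_splits)
    next
      case 3
      then have "L * p + t \<le> p" using x p below by auto
      moreover have "p = x_lo \<or> p \<le> L * p + t" using above p by (cases "x_lo < p") auto
      ultimately show ?thesis
        using 3 x p lin drift nonneg \<delta> d assms unfolding saturated_affine_def
        by (auto simp: max_def min_def abs_if split: if_splits)
    qed
  qed
  then show ?thesis
    using p \<rho> fixed by (intro bexI[of _ p] bexI[of _ \<rho>]) auto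
qed

lemma exponentially_stable_in_saturated_affine:
  assumes d: "\<And>x. x \<in> {x_lo..x_hi} \<Longrightarrow> a * x + d x = g x"
  shows "exponentially_stable_in {x_lo..x_hi} a d"
proof -
  obtain p \<rho> where p: "p \<in> {x_lo..x_hi}" "\<rho> \<in> {0<..<1}" "g p = p"
    and contr: "\<And>x. x \<in> {x_lo..x_hi} \<Longrightarrow> \<bar>g x - p\<bar> \<le> \<rho> * \<bar>x - p\<bar>"
    using contraction_to_equilibrium_leaky contraction_to_equilibrium_lossless a_le
    by (metis less_eq_real_def)
  show ?thesis
  proof (rule exponentially_stable_inI)
    show "p \<in> {x_lo..x_hi}" "a * p + d p = p" "0 < \<rho>" "\<rho> < 1"
      using p d[OF p(1)] by auto
    show "a * x + d x \<in> {x_lo..x_hi}" "\<bar>a * x + d x - p\<bar> \<le> \<rho> * \<bar>x - p\<bar>"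
      if "x \<in> {x_lo..x_hi}" for x
      using saturated_affine_mem[OF that] contr[OF that] d[OF that] by simp_all
  qed
qed

end

text \<open>The feasible inputs form an interval, and adding \<open>a * x\<close> commutes with
  \<open>max\<close> and \<open>min\<close>. The four hypotheses compare each lower bound with each
  upper bound, which makes the interval nonempty.\<close>

lemma proj_input_eq_saturated_affine:
  assumes "x_lo \<le> x_hi" "d_lo \<le> d_hi" "x_lo \<le> a * x + d_hi" "a * x + d_lo \<le> x_hi"
  shows "a * x + proj_input a q r c \<beta>\<^sub>1 \<beta>\<^sub>2 {x_lo..x_hi} {d_lo..d_hi} x =
    saturated_affine a (a + r / (q + \<beta>\<^sub>1)) ((c - \<beta>\<^sub>2) / (q + \<beta>\<^sub>1)) x_lo x_hi d_lo d_hi x"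
proof -
  define y where "y = (r * x + c - \<beta>\<^sub>2) / (q + \<beta>\<^sub>1)"
  have y: "(a + r / (q + \<beta>\<^sub>1)) * x + (c - \<beta>\<^sub>2) / (q + \<beta>\<^sub>1) = a * x + y"
    by (simp add: y_def algebra_simps add_divide_distrib diff_divide_distrib)
  have "(\<lambda>x'. x' - a * x) ` {x_lo..x_hi} \<inter> {d_lo..d_hi} =
      {max d_lo (x_lo - a * x)..min d_hi (x_hi - a * x)}"
    by auto
  then have "proj_input a q r c \<beta>\<^sub>1 \<beta>\<^sub>2 {x_lo..x_hi} {d_lo..d_hi} x =
      max (max d_lo (x_lo - a * x)) (min (min d_hi (x_hi - a * x)) y)"
    using assms by (simp add: proj_input_def closest_point_atLeastAtMost flip: y_def)
  then show ?thesis
    unfolding saturated_affine_def y by (simp add: max_add_distrib_right min_add_distrib_right)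
qed

theorem theorem1:
  fixes a q r c \<beta>\<^sub>1 \<beta>\<^sub>2 x_lo x_hi d_lo d_hi :: real
  assumes "0 < a" and "a \<le> 1"
    and "q > 0" and "\<beta>\<^sub>1 > 0" and "\<beta>\<^sub>2 > 0"
    and "x_lo \<le> x_hi" and "d_lo \<le> d_hi"
    and "a * x_lo + d_hi > x_lo" and "a * x_hi + d_lo < x_hi"
    and "\<bar>a + r / (q + \<beta>\<^sub>1)\<bar> < 1"
  shows "exponentially_stable_in {x_lo..x_hi} a
           (proj_input a q r c \<beta>\<^sub>1 \<beta>\<^sub>2 {x_lo..x_hi} {d_lo..d_hi})"
proof (rule exponentially_stable_in_saturated_affine[OF assms(1,2,10,6,8,9)])
  fix x assume x: "x \<in> {x_lo..x_hi}"
  show "a * x + proj_input a q r c \<beta>\<^sub>1 \<beta>\<^sub>2 {x_lo..x_hi} {d_lo..d_hi} x =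
      saturated_affine a (a + r / (q + \<beta>\<^sub>1)) ((c - \<beta>\<^sub>2) / (q + \<beta>\<^sub>1)) x_lo x_hi d_lo d_hi x"
    using ctrl[OF assms(1,2,10,6,8,9) x] assms(6,7)
    by (intro proj_input_eq_saturated_affine) auto
qed

end
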